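(* Let $1\le m\le n$. Suppose the concise transformation algorithm and the Bi-CR algorithm described in the context are run from the same initial guess $\bm{x}_0$ and the same initial shadow residual $\tilde{\bm{r}}_0$, and that neither breaks down in the steps $k=0,\dots,m-1$. Then the smoothed residuals $\bm{s}_k$ of the concise transformation algorithm coincide with the Bi-CR residuals $\bm{r}_k^{\rm bicr}$: $$\bm{s}_k=\bm{r}_k^{\rm bicr}\quad\text{for all } 0\le k\le m,\ k<n.$$
   Context: $(\bm{x},\bm{y})=\bm{x}^\top\bm{y}$ is the standard inner product on $\mathbb{R}^n$. $A\in\mathbb{R}^{n\times n}$ is nonsymmetric and nonsingular, $\bm{b}\in\mathbb{R}^n$; all computations are in exact arithmetic. Fix $\bm{x}_0\in\mathbb{R}^n$, $\bm{r}_0=\bm{b}-A\bm{x}_0$, and $\tilde{\bm{r}}_0\in\mathbb{R}^n$ with $(\tilde{\bm{r}}_0,\bm{r}_0)\neq0$. Concise transformation algorithm. Set $\bm{p}_0=\bm{r}_0$, $\tilde{\bm{p}}_0=\tilde{\bm{r}}_0$, $\bm{y}_0=\bm{x}_0$, $\bm{s}_0=\bm{r}_0$. Step $k$ ($k=0,1,\dots$) computes in order: - $\alpha_k=\dfrac{(\tilde{\bm{r}}_k,\bm{r}_k)}{(\tilde{\bm{p}}_k,A\bm{p}_k)}$, $\ \bm{x}_{k+1}=\bm{x}_k+\alpha_k\bm{p}_k$, - $\bm{r}_{k+1}=\bm{r}_k-\alpha_kA\bm{p}_k$, $\ \tilde{\bm{r}}_{k+1}=\tilde{\bm{r}}_k-\alpha_kA^\top\tilde{\bm{p}}_k$,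 - $\eta_{k+1}=-\dfrac{(\bm{s}_k,A^\top\tilde{\bm{p}}_k)}{(\bm{r}_{k+1}-\bm{s}_k,A^\top\tilde{\bm{p}}_k)}$, - $\bm{y}_{k+1}=\bm{y}_k+\eta_{k+1}(\bm{x}_{k+1}-\bm{y}_k)$, $\ \bm{s}_{k+1}=\bm{s}_k+\eta_{k+1}(\bm{r}_{k+1}-\bm{s}_k)$, - $\beta_k=\dfrac{(\tilde{\bm{r}}_{k+1},\bm{r}_{k+1})}{(\tilde{\bm{r}}_k,\bm{r}_k)}$, $\ \bm{p}_{k+1}=\bm{r}_{k+1}+\beta_k\bm{p}_k$, $\ \tilde{\bm{p}}_{k+1}=\tilde{\bm{r}}_{k+1}+\beta_k\tilde{\bm{p}}_k$. (The recursions for $\bm{x}_k,\bm{r}_k,\tilde{\bm{r}}_k,\bm{p}_k,\tilde{\bm{p}}_k$ are exactly those of the Bi-CG method, so $\bm{r}_k$ is the Bi-CG residual.) No breakdown in steps $0,\dots,m-1$ means $(\tilde{\bm{r}}_k,\bm{r}_k)\ne0$, $(\tilde{\bm{p}}_k,A\bm{p}_k)\ne0$ and $(\bm{r}_{k+1}-\bm{s}_k,A^\top\tilde{\bm{p}}_k)\ne0$ for $0\le k\le m-1$. Bi-CR algorithm (its quantities carry the superscript ${\rm bicr}$ and are in general different from those above). Set $\bm{x}_0^{\rm bicr}=\bm{x}_0$, $\bm{r}^{\rm bicr}_0=\bm{p}_0^{\rm bicr}=\bm{r}_0$, $\tilde{\bm{r}}_0^{\rm bicr}=\tilde{\bm{p}}_0^{\rm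 bicr}=\tilde{\bm{r}}_0$, $\bm{q}_0^{\rm bicr}=A\bm{p}_0^{\rm bicr}$. Step $k$ computes in order: - $\alpha_k^{\rm bicr}=\dfrac{(\tilde{\bm{r}}_k^{\rm bicr},A\bm{r}_k^{\rm bicr})}{(A^\top\tilde{\bm{p}}_k^{\rm bicr},\bm{q}_k^{\rm bicr})}$, $\ \bm{x}_{k+1}^{\rm bicr}=\bm{x}_k^{\rm bicr}+\alpha_k^{\rm bicr}\bm{p}_k^{\rm bicr}$, - $\bm{r}_{k+1}^{\rm bicr}=\bm{r}_k^{\rm bicr}-\alpha_k^{\rm bicr}\bm{q}_k^{\rm bicr}$, $\ \tilde{\bm{r}}_{k+1}^{\rm bicr}=\tilde{\bm{r}}_k^{\rm bicr}-\alpha_k^{\rm bicr}A^\top\tilde{\bm{p}}_k^{\rm bicr}$, - $\beta_k^{\rm bicr}=\dfrac{(\tilde{\bm{r}}_{k+1}^{\rm bicr},A\bm{r}_{k+1}^{\rm bicr})}{(\tilde{\bm{r}}_k^{\rm bicr},A\bm{r}_k^{\rm bicr})}$, - $\bm{p}_{k+1}^{\rm bicr}=\bm{r}_{k+1}^{\rm bicr}+\beta_k^{\rm bicr}\bm{p}_k^{\rm bicr}$, $\ \tilde{\bm{p}}_{k+1}^{\rm bicr}=\tilde{\bm{r}}_{k+1}^{\rm bicr}+\beta_k^{\rm bicr}\tilde{\bm{p}}_k^{\rm bicr}$, $\ \bm{q}_{k+1}^{\rm bicr}=A\bm{r}_{k+1}^{\rm bicr}+\beta_k^{\rm bicr}\bm{q}_k^{\rm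 bicr}$. No breakdown in steps $0,\dots,m-1$ means $(\tilde{\bm{r}}_k^{\rm bicr},A\bm{r}_k^{\rm bicr})\neq0$ and $(A^\top\tilde{\bm{p}}_k^{\rm bicr},\bm{q}_k^{\rm bicr})\ne0$ for $0\le k\le m-1$. *)

theory Defs
  imports "HOL-Analysis.Analysis"
begin

text \<open>
  A record value holds the iterates available at the start of step \<open>k\<close>; the suffix \<open>_sh\<close> marks
  shadow quantities (those carrying a tilde). All divisions are the total HOL ones
  (\<open>a / 0 = 0\<close>), so the iterates are the paper's only as long as no breakdown has occurred.
\<close>

record 'n concise_state =
  cx :: "real ^ 'n"
  cr :: "real ^ 'n"
  cr_sh :: "real ^ 'n"
  cp :: "real ^ 'n"
  cp_sh :: "real ^ 'n"
  cy :: "real ^ 'n"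
  cs :: "real ^ 'n"

definition concise_init ::
  "real ^ 'n ^ 'n \<Rightarrow> real ^ 'n \<Rightarrow> real ^ 'n \<Rightarrow> real ^ 'n \<Rightarrow> 'n concise_state" where
  "concise_init A b x0 rsh0 =
     (let r0 = b - A *v x0 in
      \<lparr>cx = x0, cr = r0, cr_sh = rsh0, cp = r0, cp_sh = rsh0, cy = x0, cs = r0\<rparr>)"

definition concise_step :: "real ^ 'n ^ 'n \<Rightarrow> 'n concise_state \<Rightarrow> 'n concise_state" where
  "concise_step A S =
     (let
        \<alpha> = (cr_sh S \<bullet> cr S) / (cp_sh S \<bullet> (A *v cp S));
        x' = cx S + \<alpha> *\<^sub>R cp S;
        r' = cr S - \<alpha> *\<^sub>R (A *v cp S);
        rsh' = cr_sh S - \<alpha> *\<^sub>R (transpose A *v cp_sh S);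
        \<eta> = - ((cs S \<bullet> (transpose A *v cp_sh S)) / ((r' - cs S) \<bullet> (transpose A *v cp_sh S)));
        y' = cy S + \<eta> *\<^sub>R (x' - cy S);
        s' = cs S + \<eta> *\<^sub>R (r' - cs S);
        \<beta> = (rsh' \<bullet> r') / (cr_sh S \<bullet> cr S);
        p' = r' + \<beta> *\<^sub>R cp S;
        psh' = rsh' + \<beta> *\<^sub>R cp_sh S
      in \<lparr>cx = x', cr = r', cr_sh = rsh', cp = p', cp_sh = psh', cy = y', cs = s'\<rparr>)"

primrec concise ::
  "real ^ 'n ^ 'n \<Rightarrow> real ^ 'n \<Rightarrow> real ^ 'n \<Rightarrow> real ^ 'n \<Rightarrow> nat \<Rightarrow> 'n concise_state" where
  "concise A b x0 rsh0 0 = concise_init A b x0 rsh0"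
| "concise A b x0 rsh0 (Suc k) = concise_step A (concise A b x0 rsh0 k)"

definition concise_no_breakdown ::
  "real ^ 'n ^ 'n \<Rightarrow> real ^ 'n \<Rightarrow> real ^ 'n \<Rightarrow> real ^ 'n \<Rightarrow> nat \<Rightarrow> bool" where
  "concise_no_breakdown A b x0 rsh0 m \<longleftrightarrow>
     (\<forall>k<m.
        let S = concise A b x0 rsh0 k; S' = concise A b x0 rsh0 (Suc k) in
          cr_sh S \<bullet> cr S \<noteq> 0 \<and>
          cp_sh S \<bullet> (A *v cp S) \<noteq> 0 \<and>
          (cr S' - cs S) \<bullet> (transpose A *v cp_sh S) \<noteq> 0)"

record 'n bicr_state =
  bx :: "real ^ 'n"
  br :: "real ^ 'n"
  br_sh :: "real ^ 'n"
  bp :: "real ^ 'n"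
  bp_sh :: "real ^ 'n"
  bq :: "real ^ 'n"

definition bicr_init ::
  "real ^ 'n ^ 'n \<Rightarrow> real ^ 'n \<Rightarrow> real ^ 'n \<Rightarrow> real ^ 'n \<Rightarrow> 'n bicr_state" where
  "bicr_init A b x0 rsh0 =
     (let r0 = b - A *v x0 in
      \<lparr>bx = x0, br = r0, br_sh = rsh0, bp = r0, bp_sh = rsh0, bq = A *v r0\<rparr>)"

definition bicr_step :: "real ^ 'n ^ 'n \<Rightarrow> 'n bicr_state \<Rightarrow> 'n bicr_state" where
  "bicr_step A S =
     (let
        \<alpha> = (br_sh S \<bullet> (A *v br S)) / ((transpose A *v bp_sh S) \<bullet> bq S);
        x' = bx S + \<alpha> *\<^sub>R bp S;
        r' = br S - \<alpha> *\<^sub>R bq S;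
        rsh' = br_sh S - \<alpha> *\<^sub>R (transpose A *v bp_sh S);
        \<beta> = (rsh' \<bullet> (A *v r')) / (br_sh S \<bullet> (A *v br S));
        p' = r' + \<beta> *\<^sub>R bp S;
        psh' = rsh' + \<beta> *\<^sub>R bp_sh S;
        q' = A *v r' + \<beta> *\<^sub>R bq S
      in \<lparr>bx = x', br = r', br_sh = rsh', bp = p', bp_sh = psh', bq = q'\<rparr>)"

primrec bicr ::
  "real ^ 'n ^ 'n \<Rightarrow> real ^ 'n \<Rightarrow> real ^ 'n \<Rightarrow> real ^ 'n \<Rightarrow> nat \<Rightarrow> 'n bicr_state" where
  "bicr A b x0 rsh0 0 = bicr_init A b x0 rsh0"
| "bicr A b x0 rsh0 (Suc k) = bicr_step A (bicr A b x0 rsh0 k)"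

definition bicr_no_breakdown ::
  "real ^ 'n ^ 'n \<Rightarrow> real ^ 'n \<Rightarrow> real ^ 'n \<Rightarrow> real ^ 'n \<Rightarrow> nat \<Rightarrow> bool" where
  "bicr_no_breakdown A b x0 rsh0 m \<longleftrightarrow>
     (\<forall>k<m.
        let S = bicr A b x0 rsh0 k in
          br_sh S \<bullet> (A *v br S) \<noteq> 0 \<and>
          (transpose A *v bp_sh S) \<bullet> bq S \<noteq> 0)"

end

theory Submission
  imports Defs
begin

text \<open>
  Bi-CR is Bi-CG for the bilinear form \<open>\<langle>x, y\<rangle> = x \<bullet> A y\<close> in place of the inner product, so both methods
  are biorthogonal and biconjugate for the same reason, and both generate the Krylov spaces of
  \<open>(A, r\<^sub>0)\<close> and of the transposed pair. Write \<open>K\<^sub>k\<close> and \<open>L\<^sub>k\<close> for these spaces. The Bi-CR residual and, by the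
  choice of \<open>\<eta>\<close>, the smoothed residual both lie in \<open>r\<^sub>0 + A K\<^sub>k\<close> and are orthogonal to \<open>A\<^sup>T L\<^sub>k\<close>. The
  Bi-CR directions are \<open>A\<^sup>2\<close>-biconjugate bases of \<open>K\<^sub>k\<close> and \<open>L\<^sub>k\<close> with nonzero diagonal products,
  so there is only one such vector.
\<close>

section \<open>Krylov spaces\<close>

text \<open>The index counts generators: \<open>krylov T v 0\<close> is the zero space, and iterates
  of step \<open>k\<close> lie in the space of index \<open>Suc k\<close>.\<close>

definition krylov :: "('a::real_vector \<Rightarrow> 'a) \<Rightarrow> 'a \<Rightarrow> nat \<Rightarrow> 'a set" where
  "krylov T v k = span ((\<lambda>i. (T ^^ i) v) ` {..<k})"

lemma subspace_krylov: "subspace (krylov T v k)"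
  by (simp add: krylov_def)

lemma krylov_mono: "j \<le> k \<Longrightarrow> krylov T v j \<subseteq> krylov T v k"
  unfolding krylov_def by (intro span_mono image_mono) auto

lemma start_in_krylov: "v \<in> krylov T v (Suc k)"
  unfolding krylov_def by (rule span_base) (auto intro!: image_eqI[of _ _ 0])

lemma krylov_image:
  assumes "linear T" and "x \<in> krylov T v k"
  shows "T x \<in> krylov T v (Suc k)"
proof -
  have "T x \<in> span (T ` (\<lambda>i. (T ^^ i) v) ` {..<k})"
    using assms by (auto simp: krylov_def linear_span_image)
  also have "\<dots> \<subseteq> krylov T v (Suc k)"
    unfolding krylov_def by (rule span_mono) (force intro: image_eqI[of _ _ "Suc i" for i])
  finally show ?thesis .
qed

section \<open>Coupled two-term recursions\<close>

text \<open>The coefficients are arbitrary here, so one locale covers the primal and the shadow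
  sequences of both methods.\<close>

locale two_term_recursion =
  fixes T :: "'a::real_vector \<Rightarrow> 'a" and r p :: "nat \<Rightarrow> 'a" and \<alpha> \<beta> :: "nat \<Rightarrow> real"
  assumes linear_T: "linear T"
    and p_0: "p 0 = r 0"
    and r_Suc: "r (Suc k) = r k - \<alpha> k *\<^sub>R T (p k)"
    and p_Suc: "p (Suc k) = r (Suc k) + \<beta> k *\<^sub>R p k"
begin

lemma residual_direction_in_krylov:
  "r k \<in> krylov T (r 0) (Suc k) \<and> p k \<in> krylov T (r 0) (Suc k)"
proof (induction k)
  case 0
  show ?case by (simp add: p_0 start_in_krylov)
next
  case (Suc k)
  let ?K = "krylov T (r 0) (Suc (Suc k))"
  have "r k \<in> ?K" "p k \<in> ?K"
    using Suc krylov_mono[of "Suc k" "Suc (Suc k)" T "r 0"] by auto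
  moreover have "T (p k) \<in> ?K"
    using Suc krylov_image[OF linear_T] by blast
  ultimately show ?case
    by (simp add: r_Suc p_Suc subspace_krylov subspace_add subspace_diff subspace_scale)
qed

lemma direction_in_krylov: "j < k \<Longrightarrow> p j \<in> krylov T (r 0) k"
  using residual_direction_in_krylov[of j] krylov_mono[of "Suc j" k T "r 0"] by auto

text \<open>Every increment is a multiple of \<open>T (p j)\<close>, the image of a Krylov
  vector.\<close>

lemma residual_in_image_krylov: "r k - r 0 \<in> T ` krylov T (r 0) k"
proof (induction k)
  case 0
  have "T 0 \<in> T ` krylov T (r 0) 0"
    using subspace_0[OF subspace_krylov] by blast
  then show ?case by (simp add: linear_0[OF linear_T])
next
  case (Suc k)
  let ?I = "T ` krylov T (r 0) (Suc k)"
  have sub: "subspace ?I"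
    using linear_T subspace_krylov by (rule linear_subspace_image)
  have "r k - r 0 \<in> ?I"
    using Suc krylov_mono[of k "Suc k" T "r 0"] by auto
  moreover have "T (p k) \<in> ?I"
    using direction_in_krylov[of k "Suc k"] by simp
  ultimately have "(r k - r 0) - \<alpha> k *\<^sub>R T (p k) \<in> ?I"
    using sub by (simp add: subspace_diff subspace_scale)
  then show ?case by (simp add: r_Suc algebra_simps)
qed

text \<open>Whatever \<open>\<eta>\<close> is, smoothing forms affine combinations, which stay in
  the affine space \<open>r 0 + T K\<close> containing the residuals.\<close>

lemma smoothed_in_image_krylov:
  assumes "s 0 = r 0" and "\<And>k. s (Suc k) = s k + \<eta> k *\<^sub>R (r (Suc k) - s k)"
  shows "s k - r 0 \<in> T ` krylov T (r 0) k"
proof (induction k)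
  case 0
  then show ?case using assms(1) residual_in_image_krylov[of 0] by simp
next
  case (Suc k)
  let ?I = "T ` krylov T (r 0) (Suc k)"
  have sub: "subspace ?I"
    using linear_T subspace_krylov by (rule linear_subspace_image)
  have "s k - r 0 \<in> ?I"
    using Suc krylov_mono[of k "Suc k" T "r 0"] by auto
  moreover have "r (Suc k) - r 0 \<in> ?I" by (rule residual_in_image_krylov)
  ultimately have
    "(s k - r 0) + \<eta> k *\<^sub>R ((r (Suc k) - r 0) - (s k - r 0)) \<in> ?I"
    using sub by (meson subspace_add subspace_diff subspace_scale)
  then show ?case by (simp add: assms(2) algebra_simps)
qed

section \<open>Directions as generators of the Krylov space\<close>

lemma residual_in_span_directions: "r k \<in> span (p ` {..k})"
proof (cases k)
  case 0
  then show ?thesis by (simp add: p_0[symmetric] span_base)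
next
  case (Suc l)
  have "r k = p k - \<beta> l *\<^sub>R p l" by (simp add: Suc p_Suc)
  then show ?thesis
    by (simp add: Suc span_base span_diff span_scale)
qed

text \<open>The residual recursion is solved for \<open>T (p k)\<close>, which divides by
  \<open>\<alpha> k\<close>.\<close>

lemma image_direction_in_span:
  assumes "\<alpha> k \<noteq> 0"
  shows "T (p k) \<in> span (p ` {..Suc k})"
proof -
  let ?V = "span (p ` {..Suc k})"
  have "r k \<in> ?V"
    using residual_in_span_directions[of k] span_mono[OF image_mono[of "{..k}" "{..Suc k}" p]]
    by auto
  moreover have "r (Suc k) \<in> ?V"
    by (rule residual_in_span_directions)
  moreover have "T (p k) = (1 / \<alpha> k) *\<^sub>R (r k - r (Suc k))"
    using assms by (simp add: r_Suc)
  ultimately show ?thesis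
    by (simp add: span_diff span_scale)
qed

text \<open>Each power is \<open>T\<close> applied to a span of earlier directions. The highest one,
  \<open>T ^^ (k - 1)\<close>, involves \<open>T (p j)\<close> only for
  \<open>j + 2 \<le> k\<close>, hence the bound \<open>Suc j < k\<close>.\<close>

lemma krylov_subset_span_directions:
  assumes "\<And>j. Suc j < k \<Longrightarrow> \<alpha> j \<noteq> 0"
  shows "krylov T (r 0) k \<subseteq> span (p ` {..<k})"
proof -
  have pow: "(T ^^ i) (r 0) \<in> span (p ` {..i})" if "i < k" for i
    using that
  proof (induction i)
    case 0
    then show ?case by (simp add: p_0[symmetric] span_base)
  next
    case (Suc i)
    have "T ` span (p ` {..i}) = span (T ` p ` {..i})"
      by (simp add: linear_T linear_span_image)
    also have "\<dots> \<subseteq> span (p ` {..Suc i})"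
    proof (rule span_minimal)
      show "T ` p ` {..i} \<subseteq> span (p ` {..Suc i})"
      proof clarify
        fix j assume "j \<le> i"
        then have "T (p j) \<in> span (p ` {..Suc j})"
          using Suc.prems by (intro image_direction_in_span assms) auto
        moreover have "span (p ` {..Suc j}) \<subseteq> span (p ` {..Suc i})"
          using \<open>j \<le> i\<close> by (intro span_mono image_mono) auto
        ultimately show "T (p j) \<in> span (p ` {..Suc i})" by blast
      qed
    qed simp
    finally show ?case using Suc by auto
  qed
  show ?thesis
    unfolding krylov_def
  proof (rule span_minimal)
    show "(\<lambda>i. (T ^^ i) (r 0)) ` {..<k} \<subseteq> span (p ` {..<k})"
    proof clarify
      fix i assume "i < k"
      moreover from this have "span (p ` {..i}) \<subseteq> span (p ` {..<k})"
        by (intro span_mono image_mono) auto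
      ultimately show "(T ^^ i) (r 0) \<in> span (p ` {..<k})"
        using pow by blast
    qed
  qed simp
qed

end

section \<open>Biconjugate gradients for a bilinear form\<close>

text \<open>Primal and shadow recursions share their coefficients. \<open>B\<close> is the inner
  product for Bi-CG and \<open>x \<bullet> (A *v y)\<close> for Bi-CR; the coefficient formulas are
  stated as products to avoid division.\<close>

locale biconjugate_gradients =
  primal: two_term_recursion T r p \<alpha> \<beta> + dual: two_term_recursion T' r' p' \<alpha> \<beta>
  for T T' :: "'a::real_vector \<Rightarrow> 'a" and r r' p p' :: "nat \<Rightarrow> 'a" and \<alpha> \<beta> :: "nat \<Rightarrow> real" +
  fixes B :: "'a \<Rightarrow> 'a \<Rightarrow> real" and m :: nat
  assumes bilinear_B: "bilinear B"
    and adjoint: "B (T' x) y = B x (T y)"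
    and step_length: "k < m \<Longrightarrow> \<alpha> k * B (p' k) (T (p k)) = B (r' k) (r k)"
    and step_length_nonzero: "k < m \<Longrightarrow> \<alpha> k \<noteq> 0"
    and update_coefficient: "k < m \<Longrightarrow> \<beta> k * B (r' k) (r k) = B (r' (Suc k)) (r (Suc k))"
begin

text \<open>The hypotheses are symmetric in primal and dual, so only one half of biorthogonality has
  to be proved by hand.\<close>

lemma swap: "biconjugate_gradients T' T r' r p' p \<alpha> \<beta> (\<lambda>x y. B y x) m"
proof unfold_locales
  show "bilinear (\<lambda>x y. B y x)"
    using bilinear_B by (simp add: bilinear_def)
qed (simp_all add: adjoint step_length step_length_nonzero update_coefficient)

lemmas bilinear_simps =
  bilinear_ladd[OF bilinear_B] bilinear_radd[OF bilinear_B]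
  bilinear_lsub[OF bilinear_B] bilinear_rsub[OF bilinear_B]
  bilinear_lmul[OF bilinear_B] bilinear_rmul[OF bilinear_B]
  linear_add[OF primal.linear_T] linear_diff[OF primal.linear_T]
  linear_scale[OF primal.linear_T]

section \<open>Biorthogonality and biconjugacy by simultaneous induction\<close>

definition biorthogonal_upto :: "nat \<Rightarrow> bool" where
  "biorthogonal_upto k \<longleftrightarrow>
     (\<forall>i\<le>k. \<forall>j\<le>k. i \<noteq> j \<longrightarrow> B (r' i) (r j) = 0 \<and> B (p' i) (T (p j)) = 0)"

lemma biorthogonal_step:
  assumes "biorthogonal_upto k" and "k < m" and "i \<le> k"
  shows "B (r' i) (r (Suc k)) = 0" and "B (p' i) (T (p (Suc k))) = 0"
proof -
  have res: "B (r' i) (r (Suc k)) = 0" if "i \<le> k" for i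
  proof -
    \<comment> \<open>\<open>r' i\<close> and \<open>p' i\<close> differ by a multiple of an earlier
      \<open>p' l\<close> with \<open>l < k\<close>, which is conjugate to
      \<open>p k\<close>.\<close>
    have "B (r' i) (T (p k)) = B (p' i) (T (p k))"
    proof (cases i)
      case 0
      then show ?thesis by (simp add: dual.p_0)
    next
      case (Suc l)
      have "B (p' l) (T (p k)) = 0"
        using assms(1) that Suc by (simp add: biorthogonal_upto_def)
      moreover have "r' i = p' i - \<beta> l *\<^sub>R p' l" by (simp add: Suc dual.p_Suc)
      ultimately show ?thesis by (simp add: bilinear_simps)
    qed
    then have "B (r' i) (r (Suc k)) = B (r' i) (r k) - \<alpha> k * B (p' i) (T (p k))"
      by (simp add: primal.r_Suc bilinear_simps)
    \<comment> \<open>For \<open>i = k\<close> the choice of \<open>\<alpha> k\<close> makes the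
      terms cancel; otherwise both vanish by hypothesis.\<close>
    also have "\<dots> = 0"
      using assms(1,2) that step_length[of k]
      by (cases "i = k") (simp_all add: biorthogonal_upto_def)
    finally show ?thesis .
  qed
  show "B (r' i) (r (Suc k)) = 0"
    using assms(3) by (rule res)
  have nz: "\<alpha> i \<noteq> 0" using assms(2,3) step_length_nonzero by simp
  \<comment> \<open>Scaling by \<open>\<alpha> i\<close> turns \<open>T' (p' i)\<close> into a
    difference of dual residuals, so the residual half just proved applies.\<close>
  have "\<alpha> i * B (p' i) (T (r (Suc k))) = B (\<alpha> i *\<^sub>R T' (p' i)) (r (Suc k))"
    by (simp add: bilinear_simps adjoint)
  also have "\<alpha> i *\<^sub>R T' (p' i) = r' i - r' (Suc i)" by (simp add: dual.r_Suc)
  finally have shifted: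
    "\<alpha> i * B (p' i) (T (r (Suc k))) = - B (r' (Suc i)) (r (Suc k))"
    using res[OF assms(3)] by (simp add: bilinear_simps)
  have "\<alpha> i * B (p' i) (T (p (Suc k))) =
      - B (r' (Suc i)) (r (Suc k)) + \<beta> k * (\<alpha> i * B (p' i) (T (p k)))"
    by (simp add: primal.p_Suc bilinear_simps distrib_left shifted)
  also have "\<dots> = 0"
  \<comment> \<open>For \<open>i = k\<close> the cancellation is exactly what
    \<open>\<beta> k\<close> is chosen for.\<close>
  proof (cases "i = k")
    case True
    then show ?thesis
      using assms(2) by (simp add: step_length update_coefficient)
  next
    case False
    then have "B (r' (Suc i)) (r (Suc k)) = 0" and "B (p' i) (T (p k)) = 0"
      using assms(1,3) res[of "Suc i"] by (simp_all add: biorthogonal_upto_def)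
    then show ?thesis by simp
  qed
  finally show "B (p' i) (T (p (Suc k))) = 0" using nz by simp
qed

lemma biorthogonal: "k \<le> m \<Longrightarrow> biorthogonal_upto k"
proof (induction k)
  case 0
  show ?case by (simp add: biorthogonal_upto_def)
next
  case (Suc k)
  \<comment> \<open>Exchanging the roles yields the pairs with dual index \<open>Suc k\<close>;
    \<open>adjoint\<close> then moves \<open>T'\<close> back to \<open>T\<close>.\<close>
  interpret sw: biconjugate_gradients T' T r' r p' p \<alpha> \<beta> "\<lambda>x y. B y x" m
    by (rule swap)
  have IH: "biorthogonal_upto k" and km: "k < m" using Suc by auto
  have IH': "sw.biorthogonal_upto k"
    using IH by (auto simp: sw.biorthogonal_upto_def biorthogonal_upto_def adjoint)
  note right = biorthogonal_step[OF IH km]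
  note left = sw.biorthogonal_step[OF IH' km, unfolded adjoint]
  show ?case
    unfolding biorthogonal_upto_def
  proof (intro allI impI)
    fix i j assume "i \<le> Suc k" and "j \<le> Suc k" and "i \<noteq> j"
    then consider "i \<le> k" "j \<le> k" | "i \<le> k" "j = Suc k" | "i = Suc k" "j \<le> k"
      by linarith
    then show "B (r' i) (r j) = 0 \<and> B (p' i) (T (p j)) = 0"
    proof cases
      case 1
      then show ?thesis
        using IH \<open>i \<noteq> j\<close> by (simp add: biorthogonal_upto_def)
    next
      case 2
      then show ?thesis using right by blast
    next
      case 3
      then show ?thesis using left by blast
    qed
  qed
qed

section \<open>Orthogonality to the dual Krylov spaces and uniqueness\<close>

lemma conjugate:
  assumes "i \<le> m" and "j \<le> m" and "i \<noteq> j"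
  shows "B (p' i) (T (p j)) = 0"
  using biorthogonal[of m] assms by (simp add: biorthogonal_upto_def)

lemma direction_orthogonal_residual:
  assumes "i < k" and "k \<le> m"
  shows "B (p' i) (r k) = 0"
  using assms(1)
proof (induction i)
  case 0
  then show ?case
    using biorthogonal[of m] assms(2) by (simp add: biorthogonal_upto_def dual.p_0)
next
  case (Suc i)
  then have "B (r' (Suc i)) (r k) = 0"
    using biorthogonal[of m] assms(2) by (simp add: biorthogonal_upto_def)
  then show ?case
    using Suc by (simp add: dual.p_Suc bilinear_simps)
qed

text \<open>This is the Petrov-Galerkin condition: the dual directions generate the dual Krylov
  space, and each is orthogonal to \<open>r k\<close>.\<close>

lemma residual_orthogonal_krylov:
  assumes "w \<in> krylov T' (r' 0) k" and "k \<le> m"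
  shows "B w (r k) = 0"
proof -
  have w: "w \<in> span (p' ` {..<k})"
    using assms dual.krylov_subset_span_directions[of k] step_length_nonzero by auto
  have lin: "linear (\<lambda>x. B x (r k))"
    using bilinear_B by (simp add: bilinear_def)
  have "B x (r k) = 0" if "x \<in> p' ` {..<k}" for x
    using that direction_orthogonal_residual assms(2) by auto
  then show ?thesis
    using linear_eq_0_on_span[OF lin _ w] by blast
qed

text \<open>The parameter \<open>\<eta>\<close> only has to annihilate the newest direction, which
  is the assumption \<open>current\<close>. Older directions are handled by induction, because both
  vectors being combined are already orthogonal to them.\<close>

lemma smoothed_orthogonal_krylov:
  assumes s_Suc: "\<And>k. s (Suc k) = s k + \<eta> k *\<^sub>R (r (Suc k) - s k)"
    and current: "\<And>k. k < m \<Longrightarrow> B (T' (p' k)) (s (Suc k)) = 0"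
    and "w \<in> krylov T' (r' 0) k" and "k \<le> m"
  shows "B (T' w) (s k) = 0"
proof -
  have dir: "B (T' (p' i)) (s k) = 0" if "i < k" "k \<le> m" for i k
    using that
  proof (induction k)
    case 0
    then show ?case by simp
  next
    case (Suc k)
    show ?case
    proof (cases "i = k")
      case True
      then show ?thesis using Suc.prems current by simp
    next
      case False
      \<comment> \<open>As \<open>i < k\<close>, applying \<open>T'\<close> stays within index
        \<open>Suc k\<close>, to which \<open>r (Suc k)\<close> is orthogonal.\<close>
      then have "p' i \<in> krylov T' (r' 0) k"
        using Suc.prems by (intro dual.direction_in_krylov) simp
      then have "B (T' (p' i)) (r (Suc k)) = 0"
        using residual_orthogonal_krylov krylov_image[OF dual.linear_T] Suc.prems(2) by blast
      then show ?thesis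
        using Suc False by (simp add: s_Suc bilinear_simps)
    qed
  qed
  have w: "w \<in> span (p' ` {..<k})"
    using assms(3,4) dual.krylov_subset_span_directions[of k] step_length_nonzero by auto
  have lin: "linear (\<lambda>x. B (T' x) (s k))"
    using linear_compose[OF dual.linear_T, of "\<lambda>x. B x (s k)"] bilinear_B
    by (simp add: bilinear_def o_def)
  have "B (T' x) (s k) = 0" if "x \<in> p' ` {..<k}" for x
    using that dir assms(4) by auto
  then show ?thesis
    using linear_eq_0_on_span[OF lin _ w] by blast
qed

text \<open>In the basis of directions the pairing is diagonal with nonzero entries, so each
  coefficient of \<open>v\<close> must vanish.\<close>

lemma krylov_nondegenerate:
  assumes "k \<le> m" and nonzero: "\<And>i. i < k \<Longrightarrow> B (p' i) (T (p i)) \<noteq> 0"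
    and "v \<in> krylov T (r 0) k" and "\<And>i. i < k \<Longrightarrow> B (p' i) (T v) = 0"
  shows "v = 0"
proof -
  have "v \<in> span (p ` {..<k})"
    using assms primal.krylov_subset_span_directions[of k] step_length_nonzero by auto
  then show ?thesis
    using assms(1,2,4)
  proof (induction k)
    case 0
    then show ?case by simp
  next
    case (Suc k)
    obtain c where c: "v - c *\<^sub>R p k \<in> span (p ` {..<k})"
      using Suc.prems(1) by (auto simp: lessThan_Suc span_insert)
    have lin: "linear (\<lambda>x. B (p' k) (T x))"
      using linear_compose[OF primal.linear_T, of "B (p' k)"] bilinear_B
      by (simp add: bilinear_def o_def)
    have "B (p' k) (T x) = 0" if "x \<in> p ` {..<k}" for x
      using that conjugate Suc.prems(2) by auto
    then have "B (p' k) (T (v - c *\<^sub>R p k)) = 0"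
      using linear_eq_0_on_span[OF lin _ c] by blast
    \<comment> \<open>Testing \<open>v\<close> against \<open>p' k\<close> leaves \<open>c\<close>
      times the nonzero diagonal entry.\<close>
    then have "c = 0"
      using Suc.prems(3)[of k] Suc.prems(4)[of k] by (simp add: bilinear_simps)
    then show ?case
      using Suc c by simp
  qed
qed

end

section \<open>Residual smoothing\<close>

context
  fixes A :: "real ^ 'n ^ 'n" and b x0 rsh0 :: "real ^ 'n"
begin

section \<open>Both algorithms as instances\<close>

abbreviation (input) "cg k \<equiv> concise A b x0 rsh0 k"
abbreviation (input) "cr_method k \<equiv> bicr A b x0 rsh0 k"

lemma concise_Suc:
  fixes k
  defines "S \<equiv> cg k" and "S' \<equiv> cg (Suc k)"
  shows "cr S' = cr S - ((cr_sh S \<bullet> cr S) / (cp_sh S \<bullet> (A *v cp S))) *\<^sub>R (A *v cp S)"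
    and "cr_sh S' = cr_sh S -
      ((cr_sh S \<bullet> cr S) / (cp_sh S \<bullet> (A *v cp S))) *\<^sub>R (transpose A *v cp_sh S)"
    and "cp S' = cr S' + ((cr_sh S' \<bullet> cr S') / (cr_sh S \<bullet> cr S)) *\<^sub>R cp S"
    and "cp_sh S' = cr_sh S' + ((cr_sh S' \<bullet> cr S') / (cr_sh S \<bullet> cr S)) *\<^sub>R cp_sh S"
  by (simp_all only: S_def S'_def concise.simps concise_step_def Let_def concise_state.simps)

text \<open>The first two no-breakdown conditions turn the quotients into the required product
  identities and keep the step lengths nonzero.\<close>

lemma concise_biconjugate_gradients:
  assumes "concise_no_breakdown A b x0 rsh0 m"
  shows "biconjugate_gradients ((*v) A) ((*v) (transpose A))
    (\<lambda>k. cr (cg k)) (\<lambda>k. cr_sh (cg k)) (\<lambda>k. cp (cg k)) (\<lambda>k. cp_sh (cg k))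
    (\<lambda>k. (cr_sh (cg k) \<bullet> cr (cg k)) / (cp_sh (cg k) \<bullet> (A *v cp (cg k))))
    (\<lambda>k. (cr_sh (cg (Suc k)) \<bullet> cr (cg (Suc k))) / (cr_sh (cg k) \<bullet> cr (cg k)))
    (\<bullet>) m"
proof (intro biconjugate_gradients.intro two_term_recursion.intro
    biconjugate_gradients_axioms.intro)
  show "linear ((*v) A)" and "linear ((*v) (transpose A))"
    by (rule matrix_vector_mul_linear)+
  show "bilinear ((\<bullet>) :: real ^ 'n \<Rightarrow> real ^ 'n \<Rightarrow> real)"
    by (simp add: bilinear_conv_bounded_bilinear bounded_bilinear_inner)
next
  fix k assume "k < m"
  then have "cr_sh (cg k) \<bullet> cr (cg k) \<noteq> 0" and "cp_sh (cg k) \<bullet> (A *v cp (cg k)) \<noteq> 0"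
    using assms unfolding concise_no_breakdown_def Let_def by blast+
  then show "cr_sh (cg k) \<bullet> cr (cg k) / (cp_sh (cg k) \<bullet> (A *v cp (cg k))) *
        (cp_sh (cg k) \<bullet> (A *v cp (cg k))) = cr_sh (cg k) \<bullet> cr (cg k)"
    and "cr_sh (cg k) \<bullet> cr (cg k) / (cp_sh (cg k) \<bullet> (A *v cp (cg k))) \<noteq> 0"
    and "cr_sh (cg (Suc k)) \<bullet> cr (cg (Suc k)) / (cr_sh (cg k) \<bullet> cr (cg k)) *
        (cr_sh (cg k) \<bullet> cr (cg k)) = cr_sh (cg (Suc k)) \<bullet> cr (cg (Suc k))"
    by (simp_all del: concise.simps)
next
  show "cp (cg 0) = cr (cg 0)" and "cp_sh (cg 0) = cr_sh (cg 0)"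
    by (simp_all add: concise_init_def Let_def)
next
  show "(transpose A *v x) \<bullet> y = x \<bullet> (A *v y)" for x y
    by (simp add: dot_lmul_matrix)
qed (rule concise_Suc)+

text \<open>The algorithm updates \<open>bq\<close> by its own recursion; by linearity it is the
  product that the general recursion expects.\<close>

lemma bicr_q: "bq (cr_method k) = A *v bp (cr_method k)"
proof (induction k)
  case 0
  show ?case by (simp add: bicr_init_def Let_def)
next
  case (Suc k)
  then show ?case
    by (simp add: bicr_step_def Let_def matrix_vector_right_distrib matrix_vector_mult_scaleR)
qed

lemma bicr_Suc:
  fixes k
  defines "S \<equiv> cr_method k" and "S' \<equiv> cr_method (Suc k)"
  shows "br S' = br S -
      ((br_sh S \<bullet> (A *v br S)) / ((transpose A *v bp_sh S) \<bullet> bq S)) *\<^sub>R (A *v bp S)"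
    and "br_sh S' = br_sh S -
      ((br_sh S \<bullet> (A *v br S)) / ((transpose A *v bp_sh S) \<bullet> bq S)) *\<^sub>R (transpose A *v bp_sh S)"
    and "bp S' = br S' + ((br_sh S' \<bullet> (A *v br S')) / (br_sh S \<bullet> (A *v br S))) *\<^sub>R bp S"
    and "bp_sh S' = br_sh S' + ((br_sh S' \<bullet> (A *v br S')) / (br_sh S \<bullet> (A *v br S))) *\<^sub>R bp_sh S"
  unfolding bicr_q[of k, folded S_def, symmetric]
  by (simp_all only: S_def S'_def bicr.simps bicr_step_def Let_def bicr_state.simps)

text \<open>For this form the denominator of the step length is \<open>B (p' k) (T (p k))\<close>,
  by \<open>bicr_q\<close> and moving one transpose across the inner product.\<close>

lemma bicr_biconjugate_gradients:
  assumes "bicr_no_breakdown A b x0 rsh0 m"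
  shows "biconjugate_gradients ((*v) A) ((*v) (transpose A))
    (\<lambda>k. br (cr_method k)) (\<lambda>k. br_sh (cr_method k)) (\<lambda>k. bp (cr_method k)) (\<lambda>k. bp_sh (cr_method k))
    (\<lambda>k. (br_sh (cr_method k) \<bullet> (A *v br (cr_method k))) /
      ((transpose A *v bp_sh (cr_method k)) \<bullet> bq (cr_method k)))
    (\<lambda>k. (br_sh (cr_method (Suc k)) \<bullet> (A *v br (cr_method (Suc k)))) /
      (br_sh (cr_method k) \<bullet> (A *v br (cr_method k))))
    (\<lambda>x y. x \<bullet> (A *v y)) m"
proof (intro biconjugate_gradients.intro two_term_recursion.intro
    biconjugate_gradients_axioms.intro)
  show "linear ((*v) A)" and "linear ((*v) (transpose A))"
    by (rule matrix_vector_mul_linear)+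
  show "bilinear (\<lambda>x y. x \<bullet> (A *v y))"
    by (auto simp: bilinear_def intro!: linearI
      simp: inner_add_left inner_add_right matrix_vector_right_distrib matrix_vector_mult_scaleR)
next
  let ?a = "\<lambda>k. (br_sh (cr_method k) \<bullet> (A *v br (cr_method k))) /
      ((transpose A *v bp_sh (cr_method k)) \<bullet> bq (cr_method k))"
  fix k assume "k < m"
  then have "br_sh (cr_method k) \<bullet> (A *v br (cr_method k)) \<noteq> 0"
    and "(transpose A *v bp_sh (cr_method k)) \<bullet> bq (cr_method k) \<noteq> 0"
    using assms unfolding bicr_no_breakdown_def Let_def by blast+
  then show "?a k * (bp_sh (cr_method k) \<bullet> (A *v (A *v bp (cr_method k)))) =
      br_sh (cr_method k) \<bullet> (A *v br (cr_method k))"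
    and "?a k \<noteq> 0"
    and "br_sh (cr_method (Suc k)) \<bullet> (A *v br (cr_method (Suc k))) /
        (br_sh (cr_method k) \<bullet> (A *v br (cr_method k))) *
        (br_sh (cr_method k) \<bullet> (A *v br (cr_method k))) =
      br_sh (cr_method (Suc k)) \<bullet> (A *v br (cr_method (Suc k)))"
    by (simp_all add: bicr_q dot_lmul_matrix del: bicr.simps)
next
  show "bp (cr_method 0) = br (cr_method 0)" and "bp_sh (cr_method 0) = br_sh (cr_method 0)"
    by (simp_all add: bicr_init_def Let_def)
next
  show "(transpose A *v x) \<bullet> (A *v y) = x \<bullet> (A *v (A *v y))" for x y
    by (simp add: dot_lmul_matrix)
qed (rule bicr_Suc)+

section \<open>Comparison of the two residuals\<close>

lemma smoothed_eq_bicr_residual: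
  assumes cnb: "concise_no_breakdown A b x0 rsh0 m" and bnb: "bicr_no_breakdown A b x0 rsh0 m"
    and "k \<le> m"
  shows "cs (cg k) = br (cr_method k)"
proof -
  note cg_inst = concise_biconjugate_gradients[OF cnb]
  note cr_inst = bicr_biconjugate_gradients[OF bnb]
  note cg_rec = cg_inst[THEN biconjugate_gradients.axioms(1)]
  note cr_rec = cr_inst[THEN biconjugate_gradients.axioms(1)]
  \<comment> \<open>The index is shifted: \<open>\<eta> k\<close> is the parameter used to form the
    smoothed residual of step \<open>Suc k\<close>.\<close>
  define \<eta> where "\<eta> k = - ((cs (cg k) \<bullet> (transpose A *v cp_sh (cg k))) /
    ((cr (cg (Suc k)) - cs (cg k)) \<bullet> (transpose A *v cp_sh (cg k))))" for k
  have s_Suc: "cs (cg (Suc k)) = cs (cg k) + \<eta> k *\<^sub>R (cr (cg (Suc k)) - cs (cg k))" for k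
    by (simp add: \<eta>_def concise_step_def Let_def)
  have current: "(transpose A *v cp_sh (cg k)) \<bullet> cs (cg (Suc k)) = 0" if "k < m" for k
  proof -
    have "(cr (cg (Suc k)) - cs (cg k)) \<bullet> (transpose A *v cp_sh (cg k)) \<noteq> 0"
      using cnb that unfolding concise_no_breakdown_def Let_def by blast
    then have "\<eta> k * ((cr (cg (Suc k)) - cs (cg k)) \<bullet> (transpose A *v cp_sh (cg k)))
        = - (cs (cg k) \<bullet> (transpose A *v cp_sh (cg k)))"
      by (simp add: \<eta>_def del: concise.simps)
    then show ?thesis
      by (subst inner_commute) (simp only: s_Suc[of k] inner_add_left inner_scaleR_left)
  qed
  \<comment> \<open>Common starting vectors make the Krylov spaces of the two methods
    identical.\<close>
  have start: "cs (cg 0) = cr (cg 0)" "br (cr_method 0) = cr (cg 0)"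
      "br_sh (cr_method 0) = cr_sh (cg 0)"
    by (simp_all add: concise_init_def bicr_init_def Let_def)
  let ?K = "krylov ((*v) A) (cr (cg 0)) k"
  have "cs (cg k) - cr (cg 0) \<in> (*v) A ` ?K"
    using start(1) s_Suc by (rule two_term_recursion.smoothed_in_image_krylov[OF cg_rec])
  moreover have "br (cr_method k) - cr (cg 0) \<in> (*v) A ` ?K"
    using two_term_recursion.residual_in_image_krylov[OF cr_rec, of k] start(2) by simp
  \<comment> \<open>The common base point cancels, leaving a difference in a linear space.\<close>
  ultimately have "(cs (cg k) - cr (cg 0)) - (br (cr_method k) - cr (cg 0)) \<in> (*v) A ` ?K"
    by (rule subspace_diff[OF
      linear_subspace_image[OF matrix_vector_mul_linear subspace_krylov]])
  then obtain v where v: "v \<in> ?K" "cs (cg k) - br (cr_method k) = A *v v"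
    by auto
  have "bp_sh (cr_method i) \<bullet> (A *v (A *v v)) = 0" if "i < k" for i
  proof -
    let ?w = "bp_sh (cr_method i)"
    \<comment> \<open>The Bi-CR shadow direction lies in the shared dual Krylov space, so the
      orthogonality of the smoothed residual can be tested on it too.\<close>
    have w: "?w \<in> krylov ((*v) (transpose A)) (cr_sh (cg 0)) k"
      using two_term_recursion.direction_in_krylov[OF cr_inst[THEN biconjugate_gradients.axioms(2)]
        that] start(3) by simp
    have "(transpose A *v ?w) \<bullet> cs (cg k) = 0"
      using s_Suc current w \<open>k \<le> m\<close>
      by (rule biconjugate_gradients.smoothed_orthogonal_krylov[OF cg_inst])
    moreover have "?w \<bullet> (A *v br (cr_method k)) = 0"
      using biconjugate_gradients.residual_orthogonal_krylov[OF cr_inst, of ?w k] w start(3) \<open>k \<le> m\<close>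
      by simp
    ultimately show ?thesis
      by (simp add: v(2)[symmetric] matrix_vector_mult_diff_distrib inner_diff_right
        dot_lmul_matrix)
  qed
  \<comment> \<open>These are the denominators of the Bi-CR step lengths.\<close>
  moreover have "bp_sh (cr_method i) \<bullet> (A *v (A *v bp (cr_method i))) \<noteq> 0" if "i < k" for i
    using bnb that \<open>k \<le> m\<close>
    by (simp add: bicr_no_breakdown_def Let_def bicr_q dot_lmul_matrix)
  ultimately have "v = 0"
    using biconjugate_gradients.krylov_nondegenerate[OF cr_inst \<open>k \<le> m\<close>, of v] v(1) start(2) by simp
  then show ?thesis using v(2) by simp
qed

end

theorem mainTheorem3:
  fixes A :: "real ^ 'n ^ 'n" and b x0 rsh0 :: "real ^ 'n" and m :: nat
  assumes "transpose A \<noteq> A"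
    and "invertible A"
    and "rsh0 \<bullet> (b - A *v x0) \<noteq> 0"
    and "1 \<le> m" and "m \<le> CARD('n)"
    and "concise_no_breakdown A b x0 rsh0 m"
    and "bicr_no_breakdown A b x0 rsh0 m"
  shows "\<forall>k. k \<le> m \<and> k < CARD('n) \<longrightarrow> cs (concise A b x0 rsh0 k) = br (bicr A b x0 rsh0 k)"
  using smoothed_eq_bicr_residual assms(6,7) by blast

end
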